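(* Let $\ell\ge 2$, $d\ge 2$ and $0\le k<d$ be integers. If there is a compact set $K \subseteq [0,1]^d$ that intersects each $k$-dimensional affine subspace of $\mathbb{R}^d$ that meets $[0,1]^d$ and whose $\ell$-fold sumset $\ell K$ is nowhere dense in $\mathbb{R}^d$, then $k>\frac{\ell-1}{\ell}(d-1)$.
   Context: For $K\subseteq\mathbb{R}^d$, the $\ell$-fold sumset is $\ell K = \{x_1+\dots+x_\ell : x_1,\dots,x_\ell\in K\}$ (not the dilate of $K$ by $\ell$). *)

theory Defs
  imports "HOL-Analysis.Analysis"
begin

definition fold_sumset :: "nat \<Rightarrow> 'a::comm_monoid_add set \<Rightarrow> 'a set"
  where "fold_sumset l K = {\<Sum>i<l. x i | x. \<forall>i<l. x i \<in> K}"

definition nowhere_dense :: "'a::topological_space set \<Rightarrow> bool"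
  where "nowhere_dense S \<longleftrightarrow> interior (closure S) = {}"

text \<open>The constant 1 of the vector type is the all-ones vector, so this is the cube
  of all points with every coordinate in the closed unit interval.\<close>
definition unit_cube :: "(real ^ 'n) set"
  where "unit_cube = cbox 0 1"

end

theory Submission
  imports Defs
begin

text \<open>
  Put \<open>j = d - 1 - k\<close>. Every point of a face of dimension at most \<open>j\<close> through the origin is the
  only point of the cube on a suitable \<open>k\<close>-flat, so \<open>K\<close> contains these faces. If
  \<open>l k \<le> (l - 1) (d - 1)\<close>, then \<open>k \<le> (l - 1) j\<close>, so the unit cube in some fixed \<open>k\<close> coordinates
  is a sum of \<open>l - 1\<close> such faces. On the other hand \<open>K\<close> meets every translate of this
  coordinate \<open>k\<close>-space through the cube. Cutting the cube into finitely many subcubes of side \<open>1/2\<close>,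
  a category argument gives one subcube \<open>Q\<close> whose part of \<open>K\<close> has a projection along the
  \<open>k\<close>-space with interior. Translates of a unit cube by points of \<open>Q\<close> share a common cube of
  side \<open>1/2\<close>, so adding the unit \<open>k\<close>-cube to \<open>K \<inter> Q\<close> gives a set with interior.
\<close>

lemma fold_sumset_SucI:
  assumes "s \<in> fold_sumset m K" and "p \<in> K"
  shows "s + p \<in> fold_sumset (Suc m) K"
proof -
  obtain x where x: "s = (\<Sum>i<m. x i)" "\<forall>i<m. x i \<in> K"
    using assms(1) unfolding fold_sumset_def by blast
  have "(\<Sum>i<Suc m. (x(m := p)) i) = s + p"
    by (simp add: x(1))
  moreover have "\<forall>i<Suc m. (x(m := p)) i \<in> K"
    using x(2) assms(2) by (simp add: less_Suc_eq)
  ultimately show ?thesis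
    unfolding fold_sumset_def by (smt (verit) mem_Collect_eq)
qed

lemma unit_cube_iff: "x \<in> unit_cube \<longleftrightarrow> (\<forall>i. 0 \<le> x $ i \<and> x $ i \<le> 1)"
  by (simp add: unit_cube_def mem_box_cart)

lemma affine_coordinate_flat:
  fixes y :: "real ^ 'n"
  shows "affine {z. \<forall>i\<in>J. z $ i = y $ i}"
  unfolding affine_def by (simp flip: distrib_right)

lemma aff_dim_coordinate_flat:
  fixes y :: "real ^ 'n"
  shows "aff_dim {z. \<forall>i\<in>J. z $ i = y $ i} = int (card (- J))"
proof -
  let ?W = "{z::real^'n. \<forall>i. i \<notin> - J \<longrightarrow> z $ i = 0}"
  have "{z. \<forall>i\<in>J. z $ i = y $ i} = (+) y ` ?W"
  proof (intro subset_antisym subsetI)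
    fix z assume "z \<in> {z. \<forall>i\<in>J. z $ i = y $ i}"
    then have "z - y \<in> ?W" by simp
    then show "z \<in> (+) y ` ?W" by (rule rev_image_eqI) simp
  qed auto
  moreover have "subspace ?W"
    by (simp add: subspace_def)
  ultimately show ?thesis
    using dim_substandard_cart[of "- J", where 'a = real]
    by (simp add: aff_dim_translation_eq aff_dim_subspace flip: dim_vec_eq)
qed

text \<open>Enlarge \<open>J\<close> to \<open>J'\<close> with exactly \<open>k + 1\<close>
  coordinates left outside. Fixing the coordinates in \<open>J'\<close> and requiring the others to
  sum to 0 gives a \<open>k\<close>-flat. Cube points have nonnegative coordinates, so a zero sum
  makes each of these coordinates 0, and the flat meets the cube only in \<open>y\<close>.\<close>

lemma small_faces_subset:
  fixes K :: "(real ^ 'n) set"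
  assumes k: "k < CARD('n)" and "K \<subseteq> unit_cube"
    and meets: "\<And>A. affine A \<Longrightarrow> aff_dim A = int k \<Longrightarrow> A \<inter> unit_cube \<noteq> {} \<Longrightarrow> A \<inter> K \<noteq> {}"
    and y: "y \<in> unit_cube" "\<And>i. i \<notin> J \<Longrightarrow> y $ i = 0" "card J \<le> CARD('n) - 1 - k"
  shows "y \<in> K"
proof -
  obtain J' where J': "J \<subseteq> J'" "card J' = CARD('n) - 1 - k"
    using exists_subset_between[of J "CARD('n) - 1 - k" UNIV] y(3) by auto
  have card': "card (- J') = Suc k"
    using J'(2) k by (simp add: Compl_eq_Diff_UNIV card_Diff_subset)
  define a :: "real^'n" where "a = (\<chi> i. if i \<in> J' then 0 else 1)"
  have a: "a \<bullet> z = (\<Sum>i\<in>-J'. z $ i)" for z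
    unfolding inner_vec_def by (rule sum.mono_neutral_cong_right) (auto simp: a_def)
  have y0: "y $ i = 0" if "i \<in> - J'" for i
    using y(2) J'(1) that by blast
  let ?S = "{z. \<forall>i\<in>J'. z $ i = y $ i}"
  let ?A = "?S \<inter> {z. a \<bullet> z = 0}"
  have yA: "y \<in> ?A" by (simp add: a y0)
  have "- J' \<noteq> {}" using card' by (metis card.empty nat.distinct(1))
  then obtain c where c: "c \<in> - J'" by blast
  \<comment> \<open>The hyperplane does not contain \<open>?S\<close>, so intersecting lowers the
    dimension by exactly one, from \<open>k + 1\<close> to \<open>k\<close>.\<close>
  have "y + axis c 1 \<in> ?S - {z. a \<bullet> z = 0}"
  proof -
    have "a \<bullet> axis c 1 = 1" using c by (simp add: inner_axis a_def)
    moreover have "a \<bullet> y = 0" using yA by simp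
    ultimately show ?thesis using c by (auto simp: inner_add_right axis_def)
  qed
  then have "\<not> ?S \<subseteq> {z. a \<bullet> z = 0}" by blast
  then have "aff_dim ?A = int k"
    using aff_dim_affine_Int_hyperplane[OF affine_coordinate_flat, of J' y a 0]
      yA aff_dim_coordinate_flat[of J' y] card' by (simp split: if_splits) blast
  moreover have "affine ?A"
    by (intro affine_Int affine_coordinate_flat affine_hyperplane)
  ultimately obtain p where p: "p \<in> ?A" "p \<in> K"
    using meets yA y(1) by blast
  have nonneg: "0 \<le> p $ i" for i
    using p(2) assms(2) by (auto simp: unit_cube_iff)
  have "p $ i = 0" if "i \<in> - J'" for i
    using p(1) nonneg that by (simp add: a sum_nonneg_eq_0_iff)
  then have "p = y"
    using p(1) y0 by (auto simp: vec_eq_iff)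
  then show ?thesis using p(2) by simp
qed

text \<open>Split the support into \<open>m\<close> blocks of at most \<open>j\<close> coordinates;
  the part of \<open>v\<close> on each block lies in \<open>K\<close>. The induction peels off one
  block at a time.\<close>

lemma in_fold_sumset_of_small_faces:
  fixes K :: "(real ^ 'n) set"
  assumes faces: "\<And>y J. y \<in> unit_cube \<Longrightarrow> (\<And>i. i \<notin> J \<Longrightarrow> y $ i = 0) \<Longrightarrow> card J \<le> j \<Longrightarrow> y \<in> K"
    and "v \<in> unit_cube" "\<And>i. i \<notin> T \<Longrightarrow> v $ i = 0" "card T \<le> m * j"
  shows "v \<in> fold_sumset m K"
  using assms(2-)
proof (induction m arbitrary: v T)
  case 0
  then have "T = {}" by simp
  with 0 have "v = 0" by (simp add: vec_eq_iff)
  then show ?case by (simp add: fold_sumset_def)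
next
  case (Suc m)
  \<comment> \<open>The minimum covers a support smaller than \<open>j\<close>: then
    \<open>J = T\<close> and the remainder \<open>w\<close> is 0.\<close>
  obtain J where J: "J \<subseteq> T" "card J = min j (card T)"
    using obtain_subset_with_card_n[of "min j (card T)" T] by auto
  define y w :: "real^'n" where "y = (\<chi> i. if i \<in> J then v $ i else 0)"
    and "w = (\<chi> i. if i \<in> J then 0 else v $ i)"
  have "y \<in> K"
    using Suc.prems(1) J(2) by (intro faces[of y J]) (auto simp: y_def unit_cube_iff)
  moreover have "w \<in> fold_sumset m K"
  proof (rule Suc.IH)
    show "w \<in> unit_cube" using Suc.prems(1) by (auto simp: w_def unit_cube_iff)
    show "w $ i = 0" if "i \<notin> T - J" for i
      using that Suc.prems(2) by (auto simp: w_def)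
    show "card (T - J) \<le> m * j"
      using Suc.prems(3) J by (simp add: card_Diff_subset)
  qed
  moreover have "v = w + y" by (simp add: w_def y_def vec_eq_iff)
  ultimately show ?case using fold_sumset_SucI by metis
qed

text \<open>A finite form of Baire category: joining a set with empty interior to a closed set does
  not enlarge the interior.\<close>

lemma finite_closed_cover_interior:
  fixes B :: "'i \<Rightarrow> 'a::topological_space set"
  assumes "finite I" and "\<And>i. i \<in> I \<Longrightarrow> closed (B i)" and "interior (\<Union>i\<in>I. B i) \<noteq> {}"
  shows "\<exists>i\<in>I. interior (B i) \<noteq> {}"
  using assms
proof (induction I)
  case (insert a I)
  show ?case
  proof (cases "interior (B a) = {}")
    case True
    have "interior (\<Union>i\<in>I. B i) \<noteq> {}"
      using insert.prems True interior_closed_Un_empty_interior[of "\<Union>i\<in>I. B i" "B a"] insert.hyps(1)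
      by (auto simp: Un_commute)
    then show ?thesis using insert by auto
  qed auto
qed auto

lemma fold_sumset_interior:
  fixes K :: "(real ^ 'n) set"
  assumes "compact K" and "K \<subseteq> unit_cube" and "card T = k"
    and meets: "\<And>A. affine A \<Longrightarrow> aff_dim A = int k \<Longrightarrow> A \<inter> unit_cube \<noteq> {} \<Longrightarrow> A \<inter> K \<noteq> {}"
    and sums: "\<And>v. v \<in> unit_cube \<Longrightarrow> (\<And>i. i \<notin> T \<Longrightarrow> v $ i = 0) \<Longrightarrow> v \<in> fold_sumset m K"
  shows "interior (fold_sumset (Suc m) K) \<noteq> {}"
proof -
  define V :: "(real^'n) set" where "V = {u. \<forall>i. i \<notin> T \<longrightarrow> u $ i = 0}"
  \<comment> \<open>\<open>P\<close> records the coordinates in the upper half, so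
    \<open>lo P\<close> is the lowest corner of the subcube \<open>Q P\<close>.\<close>
  define lo :: "'n set \<Rightarrow> real^'n" where "lo P = (\<chi> i. if i \<in> P then 1/2 else 0)" for P
  define Q where "Q P = cbox (lo P) (\<chi> i. lo P $ i + 1/2)" for P
  \<comment> \<open>The cylinder \<open>(K \<inter> Q P) + V\<close> stands in for the projection of
    \<open>K \<inter> Q P\<close> along \<open>V\<close>. It is closed, as the sum of a compact and
    a closed set.\<close>
  define B where "B P = (\<Union>p\<in>K \<inter> Q P. \<Union>u\<in>V. {p + u})" for P
  have V: "subspace V" by (simp add: V_def subspace_def)
  have "closed (B P)" for P
    unfolding B_def Q_def
    by (intro compact_closed_sums closed_subspace V compact_Int_closed assms(1) closed_cbox)
  moreover have "unit_cube \<subseteq> (\<Union>P. B P)"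
  proof
    fix x :: "real^'n" assume x: "x \<in> unit_cube"
    \<comment> \<open>This is the translate \<open>x + V\<close>, a \<open>k\<close>-flat through a
      cube point.\<close>
    let ?A = "{z. \<forall>i\<in>-T. z $ i = x $ i}"
    have "?A \<inter> K \<noteq> {}"
      using x affine_coordinate_flat aff_dim_coordinate_flat[of "- T" x] assms(3)
      by (intro meets) auto
    then obtain p where p: "\<forall>i\<in>-T. p $ i = x $ i" "p \<in> K" by blast
    have "p \<in> Q {i. p $ i \<ge> 1/2}"
      using p(2) assms(2) by (auto simp: Q_def lo_def mem_box_cart unit_cube_iff subset_iff)
    moreover have "x - p \<in> V" using p(1) by (simp add: V_def)
    ultimately have "x \<in> B {i. p $ i \<ge> 1/2}"
      unfolding B_def using p(2) by force
    then show "x \<in> (\<Union>P. B P)" by blast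
  qed
  moreover have "interior (unit_cube :: (real^'n) set) \<noteq> {}"
    unfolding unit_cube_def by (simp add: interval_ne_empty_cart)
  ultimately have "\<exists>P\<in>UNIV. interior (B P) \<noteq> {}"
    by (intro finite_closed_cover_interior) (simp, simp, metis interior_mono subset_empty)
  then obtain P x where x: "x \<in> interior (B P)" by blast
  \<comment> \<open>Sliding \<open>x\<close> by \<open>t\<close> along \<open>V\<close> stays in the
    interior of the \<open>V\<close>-invariant set \<open>B P\<close> and puts each coordinate in
    \<open>T\<close> at 3/4 above \<open>lo P\<close>, the middle of the window
    \<open>U\<close>.\<close>
  define t :: "real^'n" where "t = (\<chi> i. if i \<in> T then lo P $ i + 3/4 - x $ i else 0)"
  have "(+) t ` B P \<subseteq> B P"
  proof -
    have "t \<in> V" by (simp add: t_def V_def)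
    then have "t + (p + u) \<in> B P" if "p \<in> K \<inter> Q P" "u \<in> V" for p u
      using that subspace_add[OF V, of t u] unfolding B_def
      by (force simp: algebra_simps)
    then show ?thesis by (auto simp: B_def)
  qed
  then have tx: "t + x \<in> interior (B P)"
    using x interior_mono[of "(+) t ` B P" "B P"] interior_translation[of t "B P"] by blast
  \<comment> \<open>For \<open>p \<in> Q P\<close> and \<open>z \<in> U\<close>, the differences
    \<open>z $ i - p $ i\<close> with \<open>i \<in> T\<close> lie between 0 and 1, whichever
    \<open>p\<close> is taken.\<close>
  define U where "U = {z::real^'n. \<forall>i\<in>T. lo P $ i + 1/2 < z $ i \<and> z $ i < lo P $ i + 1}"
  have "U = (\<Inter>i\<in>T. {z. lo P $ i + 1/2 < z $ i} \<inter> {z. z $ i < lo P $ i + 1})"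
    by (auto simp: U_def)
  then have "open U"
    by (auto intro!: open_INT open_Int open_Collect_less continuous_intros)
  then have "open (interior (B P) \<inter> U)" by auto
  moreover have "t + x \<in> interior (B P) \<inter> U"
    using tx by (auto simp: U_def t_def)
  moreover have "interior (B P) \<inter> U \<subseteq> fold_sumset (Suc m) K"
  proof
    fix z assume z: "z \<in> interior (B P) \<inter> U"
    then have "z \<in> B P" using interior_subset by blast
    then obtain p u where pu: "p \<in> K" "p \<in> Q P" "u \<in> V" "z = p + u"
      unfolding B_def by blast
    have "u \<in> unit_cube"
      unfolding unit_cube_iff
    proof
      fix i
      show "0 \<le> u $ i \<and> u $ i \<le> 1"
      proof (cases "i \<in> T")
        case True
        then have "lo P $ i + 1/2 < p $ i + u $ i" "p $ i + u $ i < lo P $ i + 1"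
          using z pu(4) by (auto simp: U_def)
        moreover have "lo P $ i \<le> p $ i" "p $ i \<le> lo P $ i + 1/2"
          using pu(2) by (auto simp: Q_def mem_box_cart)
        ultimately show ?thesis by linarith
      next
        case False
        then show ?thesis using pu(3) by (simp add: V_def)
      qed
    qed
    then have "u \<in> fold_sumset m K"
      using pu(3) by (intro sums) (auto simp: V_def)
    from fold_sumset_SucI[OF this pu(1)] show "z \<in> fold_sumset (Suc m) K"
      by (simp add: pu(4) add.commute)
  qed
  ultimately show ?thesis using interior_maximal by blast
qed

theorem theorem8p1:
  fixes l k :: nat and K :: "(real ^ 'n) set"
  assumes "l \<ge> 2" and "CARD('n) \<ge> 2" and "k < CARD('n)"
    and "compact K" and "K \<subseteq> unit_cube"
    and "\<And>A. affine A \<Longrightarrow> aff_dim A = int k \<Longrightarrow> A \<inter> unit_cube \<noteq> {} \<Longrightarrow> A \<inter> K \<noteq> {}"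
    and "nowhere_dense (fold_sumset l K)"
  shows "real k > (real l - 1) / real l * (real CARD('n) - 1)"
proof (rule ccontr)
  assume "\<not> ?thesis"
  then have le: "real l * real k \<le> (real l - 1) * (real CARD('n) - 1)"
    using assms(1) by (simp add: field_simps)
  obtain m where m: "l = Suc m" using assms(1) by (cases l) auto
  define j where "j = CARD('n) - 1 - k"
  have j: "real j = real CARD('n) - 1 - real k"
    using assms(3) by (simp add: j_def)
  \<comment> \<open>Subtract \<open>(l - 1) * k\<close> from both sides of
    \<open>le\<close>.\<close>
  have "real k \<le> real m * real j"
    using le unfolding m j by (simp add: algebra_simps)
  then have kj: "k \<le> m * j" by (metis of_nat_le_iff of_nat_mult)
  obtain T :: "'n set" where T: "card T = k"
    using obtain_subset_with_card_n[of k "UNIV :: 'n set"] assms(3) by auto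
  \<comment> \<open>Of the \<open>l\<close> summands, \<open>m = l - 1\<close> fill the unit cube in
    the coordinates \<open>T\<close>; the last one ranges over
    \<open>K \<inter> Q P\<close>.\<close>
  have "interior (fold_sumset (Suc m) K) \<noteq> {}"
  proof (rule fold_sumset_interior[OF assms(4,5) T assms(6)])
    show "v \<in> fold_sumset m K" if "v \<in> unit_cube" "\<And>i. i \<notin> T \<Longrightarrow> v $ i = 0" for v
      using that kj T
      by (intro in_fold_sumset_of_small_faces[where j = j and T = T]
          small_faces_subset[OF assms(3,5,6)]) (auto simp: j_def)
  qed
  then show False
    using assms(7) interior_mono[OF closure_subset, of "fold_sumset l K"]
    unfolding nowhere_dense_def m by blast
qed

end
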